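(* The problem of learning a linear classifier on a convex polygon data pool is $3$-split-neighborly. That is: let $\mathcal{X}\subset\mathbb{R}^2$ be a set of $m$ points that are the vertices of a convex polygon, and let $\mathcal{H}$ be the set of equivalence classes of linear classifiers on $\mathbb{R}^2$ having the same output on $\mathcal{X}$ (i.e. the set of restrictions to $\mathcal{X}$ of linear classifiers) that satisfy $$\frac{\sum_{x\in\mathcal{X}}h(x)}{|\mathcal{X}|}\in\left[\frac14,\frac34\right].$$ Then $(\mathcal{H},\mathcal{X})$ is $3$-split-neighborly.
   Context: A linear classifier on $\mathbb{R}^2$ is a function $x\mapsto\mathbf{1}[w\cdot x+b>0]$ with $w\in\mathbb{R}^2$, $b\in\mathbb{R}$. The points are distinct, each is a genuine vertex (extreme point) of the polygon, and $m\ge3$. Hypotheses $h\in\mathcal{H}$ are functions $\mathcal{X}\to\{0,1\}$; the elements of $\mathcal{X}$ are the tests. For a nonempty finite set $V$, $\mathbb{E}_{h\in V}[f(h)]=\frac{1}{|V|}\sum_{h\in V}f(h)$. For tests $x,x'$ let $\Delta(x,x')=\{h\in\mathcal{H}: h(x)=0 \wedge h(x')=1\}$. For $\alpha\in(0,\frac12]$, define a directed graph on $\mathcal{X}$ with a directed edge $(x,x')$ iff for every $V\subseteq\Delta(x,x')$, either $|V|\le 1$ or there exists a test $\hat x\in\mathcal{X}$ with $\mathbb{E}_{h\in V}[h(\hat x)]\in[\alpha,1-\alpha]$. The problem is $\frac1\alpha$-split-neighborly if this graph is strongly connected (so $3$-split-neighborly means $\alpha=1/3$). *)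

theory Defs
  imports "HOL-Analysis.Analysis" "Graph_Theory.Graph_Theory"
begin

text \<open>
  A problem consists of a set \<open>H\<close> of hypotheses and a set \<open>X\<close> of tests. A hypothesis is a
  real-valued function whose values on \<open>X\<close> are 0 or 1.
\<close>

definition mean :: "'h set \<Rightarrow> ('h \<Rightarrow> real) \<Rightarrow> real" where
  "mean V f = (\<Sum>h\<in>V. f h) / real (card V)"

definition Delta :: "('x \<Rightarrow> real) set \<Rightarrow> 'x \<Rightarrow> 'x \<Rightarrow> ('x \<Rightarrow> real) set" where
  "Delta H x x' = {h \<in> H. h x = 0 \<and> h x' = 1}"

text \<open>
  The explicit finiteness of \<open>V\<close> only excludes the case in which \<^const>\<open>card\<close> is 0 by convention;
  it is automatic when \<open>H\<close> is finite. The graph has a loop at every vertex, since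
  \<open>Delta H x x\<close> is empty.
\<close>

definition split_edge :: "real \<Rightarrow> ('x \<Rightarrow> real) set \<Rightarrow> 'x set \<Rightarrow> 'x \<Rightarrow> 'x \<Rightarrow> bool" where
  "split_edge \<alpha> H X x x' \<longleftrightarrow>
     (\<forall>V. finite V \<and> V \<subseteq> Delta H x x' \<longrightarrow>
        card V \<le> 1 \<or> (\<exists>y\<in>X. mean V (\<lambda>h. h y) \<in> {\<alpha>..1 - \<alpha>}))"

definition split_graph :: "real \<Rightarrow> ('x \<Rightarrow> real) set \<Rightarrow> 'x set \<Rightarrow> 'x pair_pre_digraph" where
  "split_graph \<alpha> H X =
     \<lparr> pverts = X, parcs = {(x, x'). x \<in> X \<and> x' \<in> X \<and> split_edge \<alpha> H X x x'} \<rparr>"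

text \<open>The parameter \<open>k\<close> is \<open>1 / \<alpha>\<close>; the notion is meant for \<open>k \<ge> 2\<close>, that is \<open>0 < \<alpha> \<le> 1 / 2\<close>.\<close>

definition split_neighborly :: "real \<Rightarrow> ('x \<Rightarrow> real) set \<Rightarrow> 'x set \<Rightarrow> bool" where
  "split_neighborly k H X \<longleftrightarrow> strongly_connected (with_proj (split_graph (1 / k) H X))"

definition linear_classifier :: "real^2 \<Rightarrow> real \<Rightarrow> real^2 \<Rightarrow> real" where
  "linear_classifier w b x = (if w \<bullet> x + b > 0 then 1 else 0)"

text \<open>
  Classifiers with the same output on \<open>X\<close> are identified by taking their restrictions to \<open>X\<close>,
  which are extended outside \<open>X\<close> by the fixed value \<^const>\<open>undefined\<close>.
\<close>

definition linear_hypotheses :: "(real^2) set \<Rightarrow> (real^2 \<Rightarrow> real) set" where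
  "linear_hypotheses X = {restrict (linear_classifier w b) X | w b. True}"

definition balanced_linear_hypotheses :: "(real^2) set \<Rightarrow> (real^2 \<Rightarrow> real) set" where
  "balanced_linear_hypotheses X =
     {h \<in> linear_hypotheses X. (\<Sum>x\<in>X. h x) / real (card X) \<in> {1/4..3/4}}"

end

(*
  A set V of hypotheses in Delta(p, q) is split by a test as soon as its members form a chain of
  subsets of X: along a chain every count between 1 and card V - 1 is attained by some test, in
  particular the count card V / 3 rounded up. If p and q are joined by a side of the polygon, then
  Delta(p, q) is a chain: from x in h - h' and y in h' - h, the two separating lines show that
  neither {p, x}, {q, y} nor {p, y}, {q, x} can be the crossing pair of segments, so p, q, x, y
  would have the side pq crossing xy or one of x, y inside a triangle formed by the others. The
  sides connect the graph in both directions, because in the angular order around a fixed vertex z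
  consecutive vertices are joined by a side.
*)
theory Submission
  imports Defs
begin

section \<open>Counting along finite chains of sets\<close>

text \<open>Removing the largest member \<open>M\<close> lowers every positive count by exactly one,
  because a point of any member also lies in \<open>M\<close>. This drives the induction on
  \<open>k\<close>.\<close>

lemma finite_chain_count:
  assumes "finite C" and "\<And>S T. S \<in> C \<Longrightarrow> T \<in> C \<Longrightarrow> S \<subseteq> T \<or> T \<subseteq> S"
    and "1 \<le> k" and "k < card C"
  shows "\<exists>z\<in>\<Union>C. card {S \<in> C. z \<in> S} = k"
  using assms
proof (induction k arbitrary: C)
  case (Suc k)
  have "C \<noteq> {}" using Suc.prems by auto
  then have top: "\<Union>C \<in> C"
    using Suc.prems by (intro Union_in_chain) (auto simp: subset_chain_def)
  define M where "M = \<Union>C"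
  define D where "D = C - {M}"
  have C: "C = insert M D" "M \<notin> D" "finite D"
    using top Suc.prems(1) by (auto simp: M_def D_def)
  have chainD: "\<And>S T. S \<in> D \<Longrightarrow> T \<in> D \<Longrightarrow> S \<subseteq> T \<or> T \<subseteq> S"
    using Suc.prems(2) by (auto simp: D_def)
  have cardD: "k < card D" using Suc.prems(4) C by simp
  obtain z where z: "z \<in> M" "card {S \<in> D. z \<in> S} = k"
  proof (cases "k = 0")
    \<comment> \<open>The induction hypothesis does not cover count 0. Here a point of
      \<open>M\<close> outside all other members is needed; it exists because the union of
      \<open>D\<close> is itself a member of \<open>D\<close>, hence a proper subset of
      \<open>M\<close>.\<close>
    case True
    have "D \<noteq> {}" using cardD by auto
    then have "\<Union>D \<in> D"
      using C chainD by (intro Union_in_chain) (auto simp: subset_chain_def)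
    then have "\<Union>D \<noteq> M" using C by metis
    moreover have "\<Union>D \<subseteq> M" by (auto simp: D_def M_def)
    ultimately obtain z where "z \<in> M" "z \<notin> \<Union>D" by blast
    then have "{S \<in> D. z \<in> S} = {}" by auto
    then show thesis using that \<open>z \<in> M\<close> True by (metis card.empty)
  next
    case False
    then obtain z where "z \<in> \<Union>D" "card {S \<in> D. z \<in> S} = k"
      using Suc.IH[OF C(3) chainD _ cardD] by auto
    then show thesis using that by (auto simp: D_def M_def)
  qed
  have "{S \<in> C. z \<in> S} = insert M {S \<in> D. z \<in> S}" using z C by auto
  then have "card {S \<in> C. z \<in> S} = Suc k" using z C by simp
  then show ?case using z(1) unfolding M_def by blast
qed simp

lemma mean_split_if_chain:
  assumes V: "finite V" "card V \<ge> 2" "V \<subseteq> extensional X"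
    and val: "\<And>h x. h \<in> V \<Longrightarrow> x \<in> X \<Longrightarrow> h x = 0 \<or> h x = 1"
    and chain: "\<And>h h'. h \<in> V \<Longrightarrow> h' \<in> V \<Longrightarrow>
      {x \<in> X. h x = 1} \<subseteq> {x \<in> X. h' x = 1} \<or> {x \<in> X. h' x = 1} \<subseteq> {x \<in> X. h x = (1::real)}"
  shows "\<exists>y\<in>X. mean V (\<lambda>h. h y) \<in> {1/3..1 - 1/3}"
proof -
  \<comment> \<open>Extensionality makes a hypothesis recoverable from its set of ones, so counting
    sets in the chain is the same as counting hypotheses.\<close>
  define S where "S h = {x \<in> X. h x = 1}" for h :: "'a \<Rightarrow> real"
  have inj: "inj_on S V"
  proof (rule inj_onI)
    fix h h' assume h: "h \<in> V" "h' \<in> V" "S h = S h'"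
    show "h = h'"
    proof (rule extensionalityI)
      show "h \<in> extensional X" "h' \<in> extensional X" using h V by auto
      fix x assume "x \<in> X"
      moreover from this have "h x = 1 \<longleftrightarrow> h' x = 1" using h(3) by (auto simp: S_def)
      ultimately show "h x = h' x" using val h by metis
    qed
  qed
  \<comment> \<open>A third of \<open>card V\<close>, rounded up. The bound
    \<open>3 * k \<le> 2 * card V\<close> survives the rounding because
    \<open>card V \<ge> 2\<close>.\<close>
  define k where "k = (card V + 2) div 3"
  have k: "1 \<le> k" "k < card V" "card V \<le> 3 * k" "3 * k \<le> 2 * card V"
    using V(2) by (auto simp: k_def)
  have "\<exists>y\<in>\<Union>(S ` V). card {T \<in> S ` V. y \<in> T} = k"
  proof (rule finite_chain_count)
    show "finite (S ` V)" "1 \<le> k" "k < card (S ` V)"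
      using k V(1) by (simp_all add: card_image[OF inj])
    show "T \<subseteq> T' \<or> T' \<subseteq> T" if "T \<in> S ` V" "T' \<in> S ` V" for T T'
      using that chain unfolding S_def by blast
  qed
  then obtain y where y: "y \<in> \<Union>(S ` V)" "card {T \<in> S ` V. y \<in> T} = k" by blast
  have yX: "y \<in> X" using y by (auto simp: S_def)
  have "{T \<in> S ` V. y \<in> T} = S ` {h \<in> V. h y = 1}" using yX by (auto simp: S_def)
  then have "card {h \<in> V. h y = 1} = k"
    using y(2) inj by (metis (no_types, lifting) card_image inj_on_subset mem_Collect_eq subsetI)
  moreover have "(\<Sum>h\<in>V. h y) = (\<Sum>h\<in>V. if h y = 1 then 1 else 0)"
    using val yX by (intro sum.cong) auto
  ultimately have mean: "mean V (\<lambda>h. h y) = real k / real (card V)"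
    using V(1) by (simp add: mean_def sum.If_cases Int_def)
  have "real (card V) > 0" "real (card V) \<le> 3 * real k" "3 * real k \<le> 2 * real (card V)"
    using k by linarith+
  then have "real k / real (card V) \<in> {1/3..1 - 1/3}" by (simp add: field_simps)
  then show ?thesis using yX mean by metis
qed

section \<open>Signed areas and barycentric coordinates\<close>

text \<open>Twice the signed area of the triangle \<open>p q r\<close>, positive when it is
  traversed counterclockwise.\<close>

definition orient :: "real^2 \<Rightarrow> real^2 \<Rightarrow> real^2 \<Rightarrow> real" where
  "orient p q r = (q$1 - p$1) * (r$2 - p$2) - (q$2 - p$2) * (r$1 - p$1)"

lemma orient_swap: "orient q p r = - orient p q r" "orient p r q = - orient p q r"
  by (simp_all add: orient_def algebra_simps)

lemma orient_sum: "orient x q r + orient p x r + orient p q x = orient p q r"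
  by (simp add: orient_def algebra_simps)

text \<open>Barycentric coordinates as ratios of areas, with the denominator cleared so that
  degenerate triangles need no separate treatment.\<close>

lemma orient_barycentric:
  "orient p q r *\<^sub>R x = orient x q r *\<^sub>R p + orient p x r *\<^sub>R q + orient p q x *\<^sub>R r"
  by (simp add: vec_eq_iff forall_2 orient_def algebra_simps)

lemma orient_barycentric_affine:
  "orient p q r * (w \<bullet> x + b) = orient x q r * (w \<bullet> p + b) + orient p x r * (w \<bullet> q + b)
     + orient p q x * (w \<bullet> r + b)"
proof -
  have "orient p q r * (w \<bullet> x) = w \<bullet> (orient p q r *\<^sub>R x)" by simp
  also have "\<dots> = orient x q r * (w \<bullet> p) + orient p x r * (w \<bullet> q) + orient p q x * (w \<bullet> r)"
    by (simp only: orient_barycentric[of p q r x] inner_add_right inner_scaleR_right)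
  finally have "orient p q r * (w \<bullet> x) =
      orient x q r * (w \<bullet> p) + orient p x r * (w \<bullet> q) + orient p q x * (w \<bullet> r)" .
  moreover have "orient p q r * b = orient x q r * b + orient p x r * b + orient p q x * b"
    by (simp only: orient_sum[of x q r p, symmetric] distrib_right)
  ultimately show ?thesis unfolding distrib_left by linarith
qed

text \<open>Only the sign of \<open>s\<close> matters: it records on which side of the line the
  remaining vertices lie, so that either order of the endpoints is allowed.\<close>

definition polygon_side :: "(real^2) set \<Rightarrow> real^2 \<Rightarrow> real^2 \<Rightarrow> bool" where
  "polygon_side X p q \<longleftrightarrow> (\<exists>s. \<forall>x\<in>X - {p, q}. s * orient p q x > 0)"

lemma polygon_side_commute: "polygon_side X p q \<Longrightarrow> polygon_side X q p"
  unfolding polygon_side_def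
  by (metis insert_commute minus_mult_minus orient_swap(1))

section \<open>Finite sets in convex position\<close>

locale convex_position =
  fixes X :: "(real^2) set"
  assumes finite: "finite X"
    and extreme: "x \<in> X \<Longrightarrow> x extreme_point_of (convex hull X)"
begin

text \<open>Otherwise dropping \<open>x\<close> would leave the hull unchanged, and an extreme point
  of the hull of \<open>X - {x}\<close> must belong to \<open>X - {x}\<close>.\<close>

lemma notin_hull: "x \<in> X \<Longrightarrow> x \<notin> convex hull (X - {x})"
proof
  assume x: "x \<in> X" "x \<in> convex hull (X - {x})"
  have "convex hull X = convex hull (insert x (X - {x}))" using x by (simp add: insert_absorb)
  also have "\<dots> = convex hull (X - {x})" using x(2) by (rule hull_redundant)
  finally have "x extreme_point_of (convex hull (X - {x}))" using extreme x by metis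
  then show False using extreme_point_of_convex_hull by blast
qed

text \<open>The weights are left unnormalised to match the area identities, and \<open>p\<close>,
  \<open>q\<close>, \<open>r\<close> may coincide, which also covers segments.\<close>

lemma not_convex_combination:
  assumes "x \<in> X" "{p, q, r} \<subseteq> X - {x}" "a \<ge> 0" "b \<ge> 0" "c \<ge> 0" "a + b + c > 0"
  shows "(a + b + c) *\<^sub>R x \<noteq> a *\<^sub>R p + b *\<^sub>R q + c *\<^sub>R r"
proof
  assume eq: "(a + b + c) *\<^sub>R x = a *\<^sub>R p + b *\<^sub>R q + c *\<^sub>R r"
  define t where "t = a + b + c"
  have "x = (1 / t) *\<^sub>R (t *\<^sub>R x)" using assms by (simp add: t_def)
  also have "\<dots> = (a / t) *\<^sub>R p + (b / t) *\<^sub>R q + (c / t) *\<^sub>R r"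
    by (simp add: t_def eq scaleR_right_distrib)
  finally have "x = (a / t) *\<^sub>R p + (b / t) *\<^sub>R q + (c / t) *\<^sub>R r" .
  moreover have "a / t \<ge> 0" "b / t \<ge> 0" "c / t \<ge> 0" "a / t + b / t + c / t = 1"
    using assms by (simp_all add: t_def add_divide_distrib[symmetric])
  ultimately have "x \<in> convex hull {p, q, r}"
    unfolding convex_hull_3 by blast
  then show False using hull_mono[OF assms(2), of convex] notin_hull assms(1) by blast
qed

text \<open>If the conclusion failed, the three areas would be nonnegative barycentric weights
  placing \<open>x\<close> in the triangle \<open>p q r\<close>. The factor \<open>s\<close> treats
  both orientations at once.\<close>

lemma not_in_triangle:
  assumes "x \<in> X" "{p, q, r} \<subseteq> X - {x}"
    and "s * orient x q r \<ge> 0" "s * orient p x r \<ge> 0" "s * orient p q x \<ge> 0"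
  shows "s * orient p q r \<le> 0"
proof (rule ccontr)
  assume "\<not> ?thesis"
  moreover have "s * orient p q r = s * orient x q r + s * orient p x r + s * orient p q x"
    by (simp add: orient_sum[of x q r p, symmetric] algebra_simps)
  moreover have "(s * orient p q r) *\<^sub>R x =
      (s * orient x q r) *\<^sub>R p + (s * orient p x r) *\<^sub>R q + (s * orient p q x) *\<^sub>R r"
    using arg_cong[OF orient_barycentric[of p q r x], of "scaleR s"]
    by (simp add: scaleR_right_distrib)
  ultimately show False
    using not_convex_combination[OF assms] by (metis not_le)
qed

lemma classifiers_chain:
  assumes side: "polygon_side X p q" and pq: "p \<in> X" "q \<in> X"
    and f: "w \<bullet> p + b \<le> 0" "w \<bullet> q + b > 0" and g: "w' \<bullet> p + b' \<le> 0" "w' \<bullet> q + b' > 0"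
  shows "{x \<in> X. w \<bullet> x + b > 0} \<subseteq> {x \<in> X. w' \<bullet> x + b' > 0} \<or>
    {x \<in> X. w' \<bullet> x + b' > 0} \<subseteq> {x \<in> X. w \<bullet> x + b > 0}"
proof (rule ccontr)
  assume "\<not> ?thesis"
  then obtain x y where
    x: "x \<in> X" "w \<bullet> x + b > 0" "w' \<bullet> x + b' \<le> 0" and
    y: "y \<in> X" "w' \<bullet> y + b' > 0" "w \<bullet> y + b \<le> 0"
    by (auto simp: not_less subset_iff)
  have ne: "x \<noteq> p" "x \<noteq> q" "y \<noteq> p" "y \<noteq> q" "x \<noteq> y" using f g x y by auto
  obtain s where s: "\<And>z. z \<in> X - {p, q} \<Longrightarrow> s * orient p q z > 0"
    using side by (auto simp: polygon_side_def)
  define A where "A = s * orient p q x"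
  define B where "B = s * orient p q y"
  define c where "c = s * orient p x y"
  define d where "d = s * orient y q x"
  have AB: "A > 0" "B > 0" using s x y ne by (auto simp: A_def B_def)
  have c': "s * orient p y x = - c" and d': "s * orient x q y = - d"
    by (simp_all add: c_def d_def orient_def algebra_simps)
  \<comment> \<open>Any affine function at \<open>y\<close> is expressed by its values at
    \<open>p\<close>, \<open>q\<close>, \<open>x\<close>. Applied to the two classifiers, this turns
    their signs into signs of \<open>c\<close> and \<open>d\<close>.\<close>
  have eq: "A * (v \<bullet> y + e) = d * (v \<bullet> p + e) - c * (v \<bullet> q + e) + B * (v \<bullet> x + e)" for v e
    using arg_cong[OF orient_barycentric_affine[of p q x v y e], of "\<lambda>t. s * t"] c'
    by (simp add: A_def B_def d_def ring_distribs mult.assoc[symmetric])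
  have pos: "A * (w' \<bullet> y + b') > 0" "B * (w \<bullet> x + b) > 0" using AB x y by auto
  have neg: "A * (w \<bullet> y + b) \<le> 0" "B * (w' \<bullet> x + b') \<le> 0"
    using AB x y by (auto intro: mult_nonneg_nonpos)
  show False
  proof (cases "c \<ge> 0")
    case True
    then have "d * (w' \<bullet> p + b') > 0"
      using eq[of w' b'] pos neg mult_nonneg_nonneg[OF True, of "w' \<bullet> q + b'"] g by linarith
    then have "d < 0" using g by (auto simp: zero_less_mult_iff)
    \<comment> \<open>Now \<open>x\<close> has nonnegative weights with respect to \<open>p\<close>,
      \<open>q\<close>, \<open>y\<close>, so it would lie in their triangle.\<close>
    then have "s * orient p q y \<le> 0"
      using x y pq ne True AB d' by (intro not_in_triangle[of x p q y s]) (auto simp: A_def c_def)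
    then show False using AB by (simp add: B_def)
  next
    case False
    then have "d * (w \<bullet> p + b) < 0"
      using eq[of w b] pos neg mult_neg_pos[of c "w \<bullet> q + b"] f by linarith
    then have "d > 0" using f by (auto simp: mult_less_0_iff)
    \<comment> \<open>The mirrored situation: \<open>y\<close> would lie in the triangle
      \<open>p q x\<close>.\<close>
    then have "s * orient p q x \<le> 0"
      using x y pq ne False AB c' by (intro not_in_triangle[of y p q x s]) (auto simp: B_def d_def)
    then show False using AB by (simp add: A_def)
  qed
qed

section \<open>Sides as edges of the split graph\<close>

lemma split_edge_if_side:
  assumes "polygon_side X p q" "p \<in> X" "q \<in> X"
  shows "split_edge (1/3) (balanced_linear_hypotheses X) X p q"
  unfolding split_edge_def
proof (intro allI impI)
  fix V
  assume V: "finite V \<and> V \<subseteq> Delta (balanced_linear_hypotheses X) p q"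
  have H: "\<exists>w b. h = restrict (linear_classifier w b) X" "h p = 0" "h q = 1" if "h \<in> V" for h
    using V that by (auto simp: Delta_def balanced_linear_hypotheses_def linear_hypotheses_def)
  have halfplane: "\<exists>w b. w \<bullet> p + b \<le> 0 \<and> w \<bullet> q + b > 0 \<and> {x \<in> X. h x = 1} = {x \<in> X. w \<bullet> x + b > 0}"
    if h: "h \<in> V" for h
  proof -
    obtain w b where "h = restrict (linear_classifier w b) X" using H(1)[OF h] by blast
    with H(2,3)[OF h] assms show ?thesis
      by (intro exI[of _ w] exI[of _ b]) (auto simp: linear_classifier_def split: if_splits)
  qed
  show "card V \<le> 1 \<or> (\<exists>y\<in>X. mean V (\<lambda>h. h y) \<in> {1/3..1 - 1/3})"
  proof (cases "card V \<le> 1")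
    case False
    have "\<exists>y\<in>X. mean V (\<lambda>h. h y) \<in> {1/3..1 - 1/3}"
    proof (rule mean_split_if_chain)
      show "finite V" "card V \<ge> 2" using V False by auto
      show "V \<subseteq> extensional X" using H(1) by fastforce
      show "h x = 0 \<or> h x = 1" if "h \<in> V" "x \<in> X" for h x
        using H(1)[OF that(1)] that(2) by (auto simp: linear_classifier_def)
      show "{x \<in> X. h x = 1} \<subseteq> {x \<in> X. h' x = 1} \<or> {x \<in> X. h' x = 1} \<subseteq> {x \<in> X. h x = 1}"
        if hV: "h \<in> V" "h' \<in> V" for h h'
      proof -
        obtain w b where f: "w \<bullet> p + b \<le> 0" "w \<bullet> q + b > 0"
          and h: "{x \<in> X. h x = 1} = {x \<in> X. w \<bullet> x + b > 0}"
          using halfplane[OF hV(1)] by blast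
        obtain w' b' where g: "w' \<bullet> p + b' \<le> 0" "w' \<bullet> q + b' > 0"
          and h': "{x \<in> X. h' x = 1} = {x \<in> X. w' \<bullet> x + b' > 0}"
          using halfplane[OF hV(2)] by blast
        show ?thesis unfolding h h' by (rule classifiers_chain[OF assms f g])
      qed
    qed
    then show ?thesis ..
  qed simp
qed

section \<open>Connectivity along the sides\<close>

text \<open>The walk goes clockwise around the polygon, always to the angular predecessor as seen
  from \<open>z\<close>, until no vertex other than \<open>z\<close> precedes the current one; that
  last vertex is a neighbour of \<open>z\<close>.\<close>

lemma sides_connect:
  assumes z: "z \<in> X" and v: "v \<in> X"
  shows "(v, z) \<in> rtrancl_on X {(p, q). polygon_side X p q}"
proof -
  \<comment> \<open>Strict separation puts all other vertices in an open half-plane as seen from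
    \<open>z\<close>. Therefore their angular order does not wrap around and is transitive.\<close>
  have "\<exists>w b. w \<bullet> z < b \<and> (\<forall>x \<in> convex hull (X - {z}). b < w \<bullet> x)"
    using notin_hull[OF z] finite
    by (intro separating_hyperplane_closed_point)
      (auto intro!: compact_imp_closed finite_imp_compact_convex_hull)
  then obtain w b where "w \<bullet> z < b" "\<forall>x \<in> convex hull (X - {z}). b < w \<bullet> x" by blast
  moreover define l where "l x = w \<bullet> (x - z)" for x
  ultimately have l: "l x > 0" if "x \<in> X - {z}" for x
    using hull_inc[OF that, of convex] by (fastforce simp: inner_diff_right)
  have trans: "orient z x t > 0"
    if "orient z x y > 0" "orient z y t > 0" "{x, y, t} \<subseteq> X - {z}" for x y t
  proof -
    have "l y * orient z x t = l x * orient z y t + l t * orient z x y"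
      by (simp add: l_def orient_def inner_vec_def sum_2 algebra_simps)
    also have "\<dots> > 0" using that l by (intro add_pos_pos mult_pos_pos) auto
    finally show ?thesis using l[of y] that by (simp add: zero_less_mult_iff)
  qed
  have nonzero: "orient z x y \<noteq> 0" if xy: "{x, y} \<subseteq> X - {z}" "x \<noteq> y" for x y
  proof
    assume 0: "orient z x y = 0"
    have wlog: False if xy: "{x, y} \<subseteq> X - {z}" "x \<noteq> y" and 0: "orient z x y = 0"
      and le: "l x \<le> l y" for x y
    proof -
      \<comment> \<open>The left side is orthogonal to \<open>w\<close>, hence a multiple of
        \<open>w\<close> turned by a right angle. If the orientation vanishes, \<open>x\<close> lies
        on the segment from \<open>z\<close> to \<open>y\<close>.\<close>
      have "l y *\<^sub>R (x - z) - l x *\<^sub>R (y - z) = orient z x y *\<^sub>R vector [w$2, - w$1]"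
        by (simp add: l_def orient_def inner_vec_def sum_2 vec_eq_iff forall_2 algebra_simps)
      then have "l y *\<^sub>R x = (l y - l x) *\<^sub>R z + l x *\<^sub>R y" using 0 by (simp add: algebra_simps)
      moreover have "(l y - l x + l x + 0) *\<^sub>R x \<noteq> (l y - l x) *\<^sub>R z + l x *\<^sub>R y + 0 *\<^sub>R y"
        using l[of x] l[of y] le xy z by (intro not_convex_combination) auto
      ultimately show False by simp
    qed
    show False
      using wlog[of x y] wlog[of y x] 0 xy orient_swap(2)[of z x y] by (cases "l x \<le> l y") auto
  qed
  \<comment> \<open>The vertices before \<open>v\<close> in counterclockwise order around
    \<open>z\<close>; their number is the induction measure.\<close>
  define P where "P v = {u \<in> X - {z}. orient z u v > 0}" for v
  have finP: "finite (P v)" for v using finite by (simp add: P_def)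
  show ?thesis using v
  proof (induction "card (P v)" arbitrary: v rule: less_induct)
    case less
    show ?case
    proof (cases "v = z")
      case False
      then have v: "v \<in> X - {z}" using less.prems by simp
      have above: "orient z v x > 0" if "x \<in> X - {z, v}" "x \<notin> P v" for x
        using nonzero[of v x] that v orient_swap(2)[of z v x] by (auto simp: P_def)
      show ?thesis
      proof (cases "P v = {}")
        case True
        then have "polygon_side X z v"
          unfolding polygon_side_def using above by (intro exI[of _ 1]) auto
        then have "polygon_side X v z" by (rule polygon_side_commute)
        then show ?thesis using z v by (auto intro: converse_rtrancl_on_into_rtrancl_on)
      next
        case False
        have asym: "\<not> orient z y x > 0" if "orient z x y > 0" for x y
          using that orient_swap(2)[of z x y] by simp
        \<comment> \<open>The last vertex before \<open>v\<close>, which turns out to be joined to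
          \<open>v\<close> by a side.\<close>
        have "\<exists>u\<in>P v. \<forall>x\<in>P v. x \<noteq> u \<longrightarrow> \<not> orient z u x > 0"
        proof (rule Finite_Set.bex_max_element[OF finP])
          show "asymp_on (P v) (\<lambda>x y. orient z x y > 0)" using asym by (intro asymp_onI)
          show "transp_on (P v) (\<lambda>x y. orient z x y > 0)"
            by (intro transp_onI, erule trans) (auto simp: P_def)
        qed (rule False)
        then obtain u where u: "u \<in> P v" "\<And>x. x \<in> P v \<Longrightarrow> x \<noteq> u \<Longrightarrow> \<not> orient z u x > 0" by blast
        have uX: "u \<in> X - {z}" "orient z u v > 0" using u(1) by (auto simp: P_def)
        then have "u \<noteq> v" by (auto simp: orient_def)
        have "orient u v x > 0" if x: "x \<in> X - {u, v}" for x
        proof (rule ccontr)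
          assume "\<not> ?thesis"
          then have neg: "orient u v x \<le> 0" by simp
          \<comment> \<open>A vertex on the wrong side of the line \<open>u v\<close> is
            \<open>z\<close>, precedes \<open>v\<close>, or follows \<open>v\<close>. The first
            contradicts \<open>orient z u v > 0\<close>; in the second, \<open>u\<close> would lie
            in the triangle \<open>z x v\<close>; in the third, \<open>v\<close> would lie in the
            triangle \<open>z u x\<close>.\<close>
          consider "x = z" | "x \<in> P v" "x \<noteq> z" | "orient z v x > 0" "x \<noteq> z"
            using above[of x] x by auto
          then show False
          proof cases
            case 1
            then show False using neg uX orient_swap(1)[of u z v] orient_swap(2)[of u v z] by simp
          next
            case 2
            then have xu: "orient z x u > 0"
              using u(2)[of x] nonzero[of u x] uX x orient_swap(2)[of z u x] by auto
            then have "orient z x v > 0" using trans[of x u v] uX x v 2 by auto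
            moreover have "1 * orient z x v \<le> 0"
              using uX x v z 2 xu neg \<open>u \<noteq> v\<close> orient_swap(2)[of u v x]
              by (intro not_in_triangle[of u]) auto
            ultimately show False by simp
          next
            case 3
            then have "orient z u x > 0" using trans[of u v x] uX x v by auto
            moreover have "1 * orient z u x \<le> 0"
              using uX x v z 3 neg \<open>u \<noteq> v\<close> orient_swap(1)[of v u x]
              by (intro not_in_triangle[of v]) auto
            ultimately show False by simp
          qed
        qed
        then have "polygon_side X u v" unfolding polygon_side_def by (intro exI[of _ 1]) auto
        then have side: "polygon_side X v u" by (rule polygon_side_commute)
        have "P u \<subseteq> P v" using trans[of _ u v] uX v by (auto simp: P_def)
        moreover have "u \<notin> P u" by (simp add: P_def orient_def)
        ultimately have "card (P u) < card (P v)"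
          using u(1) by (intro psubset_card_mono[OF finP]) auto
        then have "(u, z) \<in> rtrancl_on X {(p, q). polygon_side X p q}"
          using less.hyps uX by blast
        then show ?thesis using side v by (auto intro: converse_rtrancl_on_into_rtrancl_on)
      qed
    qed (use z in auto)
  qed
qed

end

theorem proposition4p1:
  fixes X :: "(real^2) set" and m :: nat
  assumes "finite X"
    and "card X = m"
    and "m \<ge> 3"
    and "\<And>x. x \<in> X \<Longrightarrow> x extreme_point_of (convex hull X)"
  shows "split_neighborly 3 (balanced_linear_hypotheses X) X"
proof -
  interpret convex_position X using assms by unfold_locales
  let ?G = "with_proj (split_graph (1/3) (balanced_linear_hypotheses X) X)"
  have verts: "verts ?G = X" by (simp add: split_graph_def)
  have arc: "(p, q) \<in> arcs_ends ?G" if "polygon_side X p q" "p \<in> X" "q \<in> X" for p q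
    using split_edge_if_side[OF that] that
    by (simp add: arcs_ends_conv split_graph_def)
  have "u \<rightarrow>\<^sup>*\<^bsub>?G\<^esub> v" if "u \<in> X" "v \<in> X" for u v
    unfolding reachable_def verts using sides_connect[OF that(2,1)]
  proof (induction rule: rtrancl_on_induct)
    case (step p q)
    then show ?case using arc by (auto intro: rtrancl_on_into_rtrancl_on)
  qed auto
  \<comment> \<open>\<open>strongly_connected\<close> also demands a nonempty vertex set.\<close>
  moreover have "X \<noteq> {}" using assms by auto
  ultimately show ?thesis
    unfolding split_neighborly_def strongly_connected_def verts by blast
qed

end
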